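(* Let $\mathbb{F}_q$ be a finite field of odd characteristic $p$, let $a,b\in\mathbb{F}_q$ with $b\ne0$, let $n\ge2$ and $k\ge1$ be integers, and let $C_n^k(a,b)$ be the linear code over $\mathbb{F}_q$ with generator matrix $(I_n\ T_n(a,b,b)^k)$. Let $r$ be the largest integer such that $n+1=p^r(m+1)$ for an integer $m$ (so $\gcd(m+1,q)=1$), and write $k=p^tk'$ with $\gcd(k',q)=1$. Let $\mu$ be a primitive $4k'$-th root of $1$. Then: (1) If $r=0$, then $C_n^k(a,b)$ is LCD if and only if $$a/b\notin\{\mu^{2j+1}/b+\theta^i+\theta^{-i}:\ 1\le i\le n,\ 1\le j\le 2k'\},$$ where $\theta$ is a primitive $2(n+1)$-th root of $1$. (2) If $r\ge1$ and $m\ge1$, then $C_n^k(a,b)$ is LCD if and only if $$a/b\notin\{\mu^{2j+1}/b+2:1\le j\le2k'\}\cup\{\mu^{2j+1}/b-2:1\le j\le2k'\}\cup\{\mu^{2j+1}/b+\theta^i+\theta^{-i}:1\le i\le m,\ 1\le j\le2k'\},$$ where $\theta$ is a primitive $2(m+1)$-th root of $1$. (3) If $r\ge1$ and $m=0$, then $C_n^k(a,b)$ is LCD if and only if $$a/b\notin\{\mu^{2j+1}/b+2:1\le j\le2k'\}\cup\{\mu^{2j+1}/b-2:1\le j\le2k'\}.$$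
   Context: $T_n(a,b,b)$ denotes the $n\times n$ tridiagonal Toeplitz matrix with all diagonal entries equal to $a$, all subdiagonal and superdiagonal entries equal to $b$, and all other entries $0$; $T_n(a,b,b)^k$ is its $k$-th matrix power. $I_n$ is the identity matrix. Roots of unity are taken in an algebraic closure of $\mathbb{F}_q$. A linear code $C\subseteq\mathbb{F}_q^N$ is LCD if $C\cap C^{\perp}=\{0\}$, where $C^{\perp}=\{y\in\mathbb{F}_q^N:\sum_i x_iy_i=0\text{ for all }x\in C\}$ is the Euclidean dual. The code with generator matrix $G$ is the row space of $G$. *)

theory Defs
  imports
    "Jordan_Normal_Form.VS_Connect"
    "HOL-Algebra.Algebraic_Closure_Type"
    "HOL-Library.Cardinality"
begin

text \<open>The symmetric Toeplitz matrix \<open>T\<^sub>n(a, b, b)\<close>.\<close>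

definition tridiag_toeplitz :: "nat \<Rightarrow> 'a :: zero \<Rightarrow> 'a \<Rightarrow> 'a mat" where
  "tridiag_toeplitz n a b =
     mat n n (\<lambda>(i, j). if i = j then a else if i = j + 1 \<or> j = i + 1 then b else 0)"

text \<open>The block matrix \<open>(A B)\<close>; both lower blocks have no rows.\<close>

definition append_cols :: "'a :: zero mat \<Rightarrow> 'a mat \<Rightarrow> 'a mat" where
  "append_cols A B = four_block_mat A B (0\<^sub>m 0 (dim_col A)) (0\<^sub>m 0 (dim_col B))"

definition code_of_generator :: "'a :: field mat \<Rightarrow> 'a vec set" where
  "code_of_generator G = vec_space.row_space (dim_col G) G"

text \<open>The scalar product of vectors is the bilinear one (no conjugation), so
  \<open>orthogonal_complement\<close> is the Euclidean dual.\<close>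

definition euclidean_dual :: "nat \<Rightarrow> 'a :: field vec set \<Rightarrow> 'a vec set" where
  "euclidean_dual N C = vec_module.orthogonal_complement N C"

definition is_LCD :: "nat \<Rightarrow> 'a :: field vec set \<Rightarrow> bool" where
  "is_LCD N C \<longleftrightarrow> C \<inter> euclidean_dual N C = {0\<^sub>v N}"

definition toeplitz_code :: "nat \<Rightarrow> nat \<Rightarrow> 'a :: field \<Rightarrow> 'a \<Rightarrow> 'a vec set" where
  "toeplitz_code n k a b =
     code_of_generator (append_cols (1\<^sub>m n) (tridiag_toeplitz n a b ^\<^sub>m k))"

definition primitive_root_of_unity :: "nat \<Rightarrow> 'a :: field \<Rightarrow> bool" where
  "primitive_root_of_unity d x \<longleftrightarrow>
     d > 0 \<and> x ^ d = 1 \<and> (\<forall>e. 0 < e \<and> e < d \<longrightarrow> x ^ e \<noteq> 1)"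

end

theory Submission
  imports Defs "Jordan_Normal_Form.Char_Poly"
begin

text \<open>
  For a generator matrix \<open>G = (I B)\<close> the code is LCD iff \<open>G G\<^sup>T = I + B B\<^sup>T\<close> is invertible.
  Since \<open>T\<close> is symmetric, this matrix is \<open>I + T\<^sup>2\<^sup>k\<close>, which is singular iff \<open>T\<close> has an eigenvalue
  \<open>x\<close> in the algebraic closure with \<open>x\<^sup>2\<^sup>k = -1\<close>; by the injectivity of Frobenius these \<open>x\<close> are the odd
  powers of \<open>\<mu>\<close>. The eigenvector equation of \<open>T\<close> is the recurrence
  \<open>f(i + 2) = y f(i + 1) - f(i)\<close> with \<open>y = (x - a) / b\<close> and boundary values \<open>f(0) = f(n + 1) = 0\<close>.
  Writing \<open>y = s + 1/s\<close>, its solution is proportional to \<open>s\<^sup>i - s\<^sup>-\<^sup>i\<close> if \<open>s\<^sup>2 \<noteq> 1\<close>, so that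
  \<open>s\<close> is a root of unity of order dividing \<open>2(n + 1)\<close>, and to \<open>s\<^sup>i i\<close> otherwise, so that
  \<open>y = 2\<close> and \<open>y = -2\<close> occur iff \<open>p\<close> divides \<open>n + 1\<close>.
\<close>

section \<open>Codes with a systematic generator matrix\<close>

lemma transpose_append_cols_mult_vec:
  fixes A B :: "'a :: comm_semiring_1 mat"
  assumes A: "A \<in> carrier_mat n m1" and B: "B \<in> carrier_mat n m2" and y: "y \<in> carrier_vec n"
  shows "(append_cols A B)\<^sup>T *\<^sub>v y = (A\<^sup>T *\<^sub>v y) @\<^sub>v (B\<^sup>T *\<^sub>v y)"
proof (rule eq_vecI)
  fix i assume i: "i < dim_vec ((A\<^sup>T *\<^sub>v y) @\<^sub>v (B\<^sup>T *\<^sub>v y))"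
  have "col (append_cols A B) i = (if i < m1 then col A i else col B (i - m1))"
    by (rule eq_vecI) (use i A B in \<open>auto simp: append_cols_def\<close>)
  then show "((append_cols A B)\<^sup>T *\<^sub>v y) $ i = ((A\<^sup>T *\<^sub>v y) @\<^sub>v (B\<^sup>T *\<^sub>v y)) $ i"
    using i A B by (auto simp: append_cols_def)
qed (use A B in \<open>auto simp: append_cols_def\<close>)

lemma mult_mat_zero_vec:
  fixes A :: "'a :: semiring_0 mat"
  assumes "A \<in> carrier_mat n m"
  shows "A *\<^sub>v 0\<^sub>v m = 0\<^sub>v n"
  by (rule eq_vecI) (use assms in \<open>auto simp: scalar_prod_def\<close>)

lemma systematic_code_eq:
  fixes B :: "'a :: field mat"
  assumes B: "B \<in> carrier_mat n m"
  shows "code_of_generator (append_cols (1\<^sub>m n) B) = (\<lambda>v. v @\<^sub>v (B\<^sup>T *\<^sub>v v)) ` carrier_vec n"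
proof -
  have G: "append_cols (1\<^sub>m n) B \<in> carrier_mat n (n + m)"
    using B by (auto simp: append_cols_def)
  then have d: "dim_row (append_cols (1\<^sub>m n) B) = n" "dim_col (append_cols (1\<^sub>m n) B) = n + m"
    by auto
  have e: "(append_cols (1\<^sub>m n) B)\<^sup>T *\<^sub>v y = y @\<^sub>v (B\<^sup>T *\<^sub>v y)" if "y \<in> carrier_vec n" for y
    using transpose_append_cols_mult_vec[OF one_carrier_mat B that] that by simp
  show ?thesis
    unfolding code_of_generator_def d vec_space.row_space_eq[OF G]
    using B e by (auto simp: image_iff)
qed

text \<open>With M = I + B B^T, the codewords of v and w have scalar product (M v) . w. Hence the
  codeword of v lies in the dual iff M v = 0. As the identity block makes encoding injective, the
  intersection is trivial iff M has trivial kernel.\<close>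

lemma systematic_is_LCD_iff:
  fixes B :: "'a :: field mat"
  assumes B: "B \<in> carrier_mat n m"
  shows "is_LCD (n + m) (code_of_generator (append_cols (1\<^sub>m n) B)) \<longleftrightarrow>
    det (1\<^sub>m n + B * B\<^sup>T) \<noteq> 0"
proof -
  let ?M = "1\<^sub>m n + B * B\<^sup>T" and ?c = "\<lambda>v. v @\<^sub>v (B\<^sup>T *\<^sub>v v)"
  let ?C = "code_of_generator (append_cols (1\<^sub>m n) B)"
  have M: "?M \<in> carrier_mat n n" using B by auto
  have sp: "?c v \<bullet> ?c w = (?M *\<^sub>v v) \<bullet> w" if v: "v \<in> carrier_vec n" and w: "w \<in> carrier_vec n" for v w
  proof -
    have Bv: "B\<^sup>T *\<^sub>v v \<in> carrier_vec m" and Bw: "B\<^sup>T *\<^sub>v w \<in> carrier_vec m"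
      using B v w mult_mat_vec_carrier[of "B\<^sup>T" m n] by simp_all
    have "(B\<^sup>T *\<^sub>v w) \<bullet> (B\<^sup>T *\<^sub>v v) = w \<bullet> (B *\<^sub>v (B\<^sup>T *\<^sub>v v))"
      using transpose_vec_mult_scalar[OF B Bv w] .
    also have "\<dots> = (B * B\<^sup>T *\<^sub>v v) \<bullet> w"
      using B v w by (subst assoc_mult_mat_vec[of _ n m _ n]) (auto intro: comm_scalar_prod)
    finally have "(B\<^sup>T *\<^sub>v v) \<bullet> (B\<^sup>T *\<^sub>v w) = (B * B\<^sup>T *\<^sub>v v) \<bullet> w"
      using comm_scalar_prod[OF Bv Bw] by simp
    moreover have "?M *\<^sub>v v = v + B * B\<^sup>T *\<^sub>v v"
      using B v by (subst add_mult_distrib_mat_vec[of _ n n]) auto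
    moreover have "?c v \<bullet> ?c w = v \<bullet> w + (B\<^sup>T *\<^sub>v v) \<bullet> (B\<^sup>T *\<^sub>v w)"
      by (rule scalar_prod_append) (use v w Bv Bw in auto)
    moreover have "B * B\<^sup>T *\<^sub>v v \<in> carrier_vec n"
      using B v by auto
    ultimately show ?thesis
      using v w by (simp add: add_scalar_prod_distrib[of _ n])
  qed
  have orth: "(\<forall>w\<in>carrier_vec n. ?c v \<bullet> ?c w = 0) \<longleftrightarrow> ?M *\<^sub>v v = 0\<^sub>v n"
    if v: "v \<in> carrier_vec n" for v
  proof
    assume *: "\<forall>w\<in>carrier_vec n. ?c v \<bullet> ?c w = 0"
    show "?M *\<^sub>v v = 0\<^sub>v n"
    proof (rule eq_vecI)
      \<comment> \<open>Testing against unit vectors suffices: each one reads off a coordinate of M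
        v.\<close>
      fix i assume i: "i < dim_vec (0\<^sub>v n :: 'a vec)"
      have "(?M *\<^sub>v v) \<bullet> unit_vec n i = 0" using * sp[OF v, of "unit_vec n i"] i by simp
      then show "(?M *\<^sub>v v) $ i = 0\<^sub>v n $ i"
        using i M v scalar_prod_right_unit[of i n "?M *\<^sub>v v"] by (metis index_zero_vec mult_mat_vec_carrier)
    qed (use B in auto)
  qed (auto simp: sp v)
  have z: "?c v = 0\<^sub>v (n + m) \<longleftrightarrow> v = 0\<^sub>v n" if v: "v \<in> carrier_vec n" for v
  proof
    assume *: "?c v = 0\<^sub>v (n + m)"
    show "v = 0\<^sub>v n"
    proof (rule eq_vecI)
      fix i assume i: "i < dim_vec (0\<^sub>v n :: 'a vec)"
      then show "v $ i = 0\<^sub>v n $ i" using arg_cong[OF *, of "\<lambda>u. vec_index u i"] v B by simp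
    qed (use v in auto)
  next
    assume "v = 0\<^sub>v n"
    then show "?c v = 0\<^sub>v (n + m)" using B by (intro eq_vecI) auto
  qed
  have c: "?c v \<in> carrier_vec (n + m)" if "v \<in> carrier_vec n" for v using that B by auto
  have "?C \<inter> euclidean_dual (n + m) ?C = ?c ` {v \<in> carrier_vec n. ?M *\<^sub>v v = 0\<^sub>v n}"
    unfolding euclidean_dual_def vec_module.orthogonal_complement_def systematic_code_eq[OF B]
    using c orth by auto
  also have "\<dots> = {0\<^sub>v (n + m)} \<longleftrightarrow> {v \<in> carrier_vec n. ?M *\<^sub>v v = 0\<^sub>v n} = {0\<^sub>v n}"
  proof
    assume eq: "?c ` {v \<in> carrier_vec n. ?M *\<^sub>v v = 0\<^sub>v n} = {0\<^sub>v (n + m)}"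
    have "v = 0\<^sub>v n" if "v \<in> carrier_vec n" "?M *\<^sub>v v = 0\<^sub>v n" for v
      using eq that z[of v] by blast
    then show "{v \<in> carrier_vec n. ?M *\<^sub>v v = 0\<^sub>v n} = {0\<^sub>v n}"
      using eq z[of "0\<^sub>v n"] by blast
  qed (use z[of "0\<^sub>v n"] in auto)
  also have "\<dots> \<longleftrightarrow> det ?M \<noteq> 0"
  proof -
    have "?M *\<^sub>v 0\<^sub>v n = 0\<^sub>v n" using M by (rule mult_mat_zero_vec)
    then show ?thesis
      unfolding det_0_iff_vec_prod_zero[OF M] by auto
  qed
  finally show ?thesis by (simp add: is_LCD_def)
qed

section \<open>Matrix powers, polynomials in a matrix, and eigenvalues\<close>

lemma pow_mat_add:
  fixes A :: "'a :: semiring_1 mat"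
  assumes A: "A \<in> carrier_mat n n"
  shows "A ^\<^sub>m (i + j) = A ^\<^sub>m i * A ^\<^sub>m j"
proof (induction j)
  case (Suc j)
  then show ?case
    using A assoc_mult_mat[of "A ^\<^sub>m i" n n "A ^\<^sub>m j" n A n] by simp
qed (use A in auto)

lemma transpose_pow_mat:
  fixes A :: "'a :: comm_semiring_1 mat"
  assumes A: "A \<in> carrier_mat n n"
  shows "(A ^\<^sub>m k)\<^sup>T = A\<^sup>T ^\<^sub>m k"
proof (induction k)
  case (Suc k)
  have "(A ^\<^sub>m Suc k)\<^sup>T = A\<^sup>T * A\<^sup>T ^\<^sub>m k"
    using A Suc by (simp add: transpose_mult[of _ n n])
  \<comment> \<open>Powers grow by a factor on the right, but transposition puts it on the left;
    splitting the exponent as 1 + k reconciles the two.\<close>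
  also have "\<dots> = A\<^sup>T ^\<^sub>m Suc k"
    using pow_mat_add[of "A\<^sup>T" n 1 k] A by simp
  finally show ?case .
qed (use A in auto)

text \<open>This is f(A) v by Horner's scheme; only vectors occur, and the matrix f(A) is never
  formed.\<close>

definition mat_poly_vec :: "'a :: comm_ring_1 poly \<Rightarrow> 'a mat \<Rightarrow> 'a vec \<Rightarrow> 'a vec" where
  "mat_poly_vec f A v = fold_coeffs (\<lambda>c w. c \<cdot>\<^sub>v v + A *\<^sub>v w) f (0\<^sub>v (dim_vec v))"

context
  fixes A :: "'a :: comm_ring_1 mat" and v :: "'a vec" and n :: nat
  assumes A: "A \<in> carrier_mat n n" and v: "v \<in> carrier_vec n"
begin

lemma mat_poly_vec_0 [simp]: "mat_poly_vec 0 A v = 0\<^sub>v n"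
  using v by (simp add: mat_poly_vec_def)

lemma mat_poly_vec_pCons [simp]:
  "mat_poly_vec (pCons c f) A v = c \<cdot>\<^sub>v v + A *\<^sub>v mat_poly_vec f A v"
\<comment> \<open>\<open>fold_coeffs\<close> unfolds at \<open>pCons\<close> except when this
  represents the zero polynomial, where both sides vanish.\<close>
proof (cases "c = 0 \<and> f = 0")
  case True
  have "A *\<^sub>v 0\<^sub>v n = 0\<^sub>v n"
    using A by (rule mult_mat_zero_vec)
  then show ?thesis using True A v by auto
next
  case False
  then show ?thesis by (auto simp: mat_poly_vec_def)
qed

lemma mat_poly_vec_carrier [simp]: "mat_poly_vec f A v \<in> carrier_vec n"
  by (induction f) (use A v in auto)

lemma mat_poly_vec_add: "mat_poly_vec (f + g) A v = mat_poly_vec f A v + mat_poly_vec g A v"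
proof (induction f g rule: poly_induct2)
  case (pCons c f d g)
  have "(c + d) \<cdot>\<^sub>v v + (A *\<^sub>v mat_poly_vec f A v + A *\<^sub>v mat_poly_vec g A v) =
    c \<cdot>\<^sub>v v + A *\<^sub>v mat_poly_vec f A v + (d \<cdot>\<^sub>v v + A *\<^sub>v mat_poly_vec g A v)"
    by (rule eq_vecI) (use A v in \<open>auto simp: algebra_simps\<close>)
  then show ?case using A pCons by (simp add: mult_add_distrib_mat_vec[of _ n n])
qed simp

lemma mat_poly_vec_smult: "mat_poly_vec (Polynomial.smult c f) A v = c \<cdot>\<^sub>v mat_poly_vec f A v"
proof (induction f)
  case (pCons d f)
  have "A *\<^sub>v (c \<cdot>\<^sub>v mat_poly_vec f A v) = c \<cdot>\<^sub>v (A *\<^sub>v mat_poly_vec f A v)"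
    by (rule eq_vecI) (use A v in \<open>auto simp: carrier_vecD[OF mat_poly_vec_carrier]\<close>)
  moreover have "(c * d) \<cdot>\<^sub>v v + c \<cdot>\<^sub>v (A *\<^sub>v mat_poly_vec f A v) =
    c \<cdot>\<^sub>v (d \<cdot>\<^sub>v v + A *\<^sub>v mat_poly_vec f A v)"
    by (rule eq_vecI) (use A v in \<open>auto simp: algebra_simps\<close>)
  ultimately show ?case using pCons by simp
qed (auto intro!: eq_vecI)

lemma mat_poly_vec_linear_mult:
  "mat_poly_vec ([:- x, 1:] * f) A v = A *\<^sub>v mat_poly_vec f A v + (- x) \<cdot>\<^sub>v mat_poly_vec f A v"
proof -
  have "[:- x, 1:] * f = pCons 0 f + Polynomial.smult (- x) f" by simp
  then show ?thesis
    using A v by (simp only: mat_poly_vec_add mat_poly_vec_smult mat_poly_vec_pCons)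
      (auto intro!: eq_vecI simp: carrier_vecD[OF mat_poly_vec_carrier])
qed

lemma mat_poly_vec_monom: "mat_poly_vec (Polynomial.monom 1 k) A v = A ^\<^sub>m k *\<^sub>v v"
proof (induction k)
  case 0
  then show ?case using A v by (auto simp: monom_0)
next
  case (Suc k)
  have "A ^\<^sub>m Suc k *\<^sub>v v = A * A ^\<^sub>m k *\<^sub>v v"
    using pow_mat_add[OF A, of 1 k] A by simp
  also have "\<dots> = A *\<^sub>v (A ^\<^sub>m k *\<^sub>v v)"
    by (rule assoc_mult_mat_vec) (use A v in auto)
  finally show ?case using Suc A v by (auto simp: monom_Suc)
qed

end

text \<open>If \<open>f(A) v = 0\<close> then peeling off the linear factors of \<open>f\<close> one after the other meets a
  non-zero vector that is annihilated by one of them.\<close>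

lemma mat_poly_vec_eq_0_imp_eigenvalue:
  fixes A :: "'a :: alg_closed_field mat"
  assumes A: "A \<in> carrier_mat n n" and v: "v \<in> carrier_vec n" "v \<noteq> 0\<^sub>v n"
    and "f \<noteq> 0" and "mat_poly_vec f A v = 0\<^sub>v n"
  shows "\<exists>x. poly f x = 0 \<and> eigenvalue A x"
  using assms(4,5)
proof (induction "Polynomial.degree f" arbitrary: f rule: less_induct)
  case less
  show ?case
  \<comment> \<open>A constant f is a non-zero c, and c v = 0 contradicts v being non-zero.\<close>
  proof (cases "Polynomial.degree f = 0")
    case True
    then obtain c where f: "f = [:c:]" by (elim degree_eq_zeroE)
    have "A *\<^sub>v 0\<^sub>v n = 0\<^sub>v n" using A by (rule mult_mat_zero_vec)
    then have c: "c \<noteq> 0" and "c \<cdot>\<^sub>v v = 0\<^sub>v n"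
      using less.prems f A v by auto
    have "v = 0\<^sub>v n"
    proof (rule eq_vecI)
      fix i assume "i < dim_vec (0\<^sub>v n :: 'a vec)"
      then show "vec_index v i = vec_index (0\<^sub>v n) i"
        using arg_cong[OF \<open>c \<cdot>\<^sub>v v = 0\<^sub>v n\<close>, of "\<lambda>u. vec_index u i"] c v by simp
    qed (use v in auto)
    then show ?thesis using v by simp
  next
    case False
    then obtain x where "poly f x = 0"
      using alg_closed_imp_poly_has_root[of f] by auto
    then obtain g where f: "f = [:- x, 1:] * g"
      by (auto simp: poly_eq_0_iff_dvd dvd_def)
    let ?w = "mat_poly_vec g A v"
    have w: "?w \<in> carrier_vec n" using A v by simp
    have eq: "A *\<^sub>v ?w + (- x) \<cdot>\<^sub>v ?w = 0\<^sub>v n"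
      using less.prems A v by (simp only: f mat_poly_vec_linear_mult)
    show ?thesis
    proof (cases "?w = 0\<^sub>v n")
      case True
      have g: "g \<noteq> 0" using less.prems f by auto
      then have "Polynomial.degree g < Polynomial.degree f"
        using f by (simp add: degree_mult_eq del: mult_pCons_left)
      from less.hyps[OF this g True] show ?thesis using f by auto
    next
      case False
      have "A *\<^sub>v ?w = x \<cdot>\<^sub>v ?w"
      proof (rule eq_vecI)
        fix i assume i: "i < dim_vec (x \<cdot>\<^sub>v ?w)"
        then have "(A *\<^sub>v ?w + (- x) \<cdot>\<^sub>v ?w) $ i = 0" using eq w by auto
        then show "(A *\<^sub>v ?w) $ i = (x \<cdot>\<^sub>v ?w) $ i" using i A w by (simp del: index_mult_mat_vec)
      qed (use A w in auto)
      then have "eigenvector A ?w x"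
        unfolding eigenvector_def using A w False by auto
      then show ?thesis using \<open>poly f x = 0\<close> by (auto simp: eigenvalue_def)
    qed
  qed
qed

text \<open>A kernel vector v satisfies f(A) v = 0 for f = 1 + X^k, so some root of f is an
  eigenvalue. Conversely, an eigenvector for x with x^k = -1 is sent to its negative by A^k. No
  triangular form is required.\<close>

lemma det_one_add_pow_mat_eq_0_iff:
  fixes A :: "'a :: alg_closed_field mat"
  assumes A: "A \<in> carrier_mat n n" and k: "k > 0"
  shows "det (1\<^sub>m n + A ^\<^sub>m k) = 0 \<longleftrightarrow> (\<exists>x. x ^ k = -1 \<and> eigenvalue A x)"
proof -
  have M: "1\<^sub>m n + A ^\<^sub>m k \<in> carrier_mat n n" using A by auto
  have mult: "(1\<^sub>m n + A ^\<^sub>m k) *\<^sub>v v = v + A ^\<^sub>m k *\<^sub>v v" if "v \<in> carrier_vec n" for v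
    using A that by (subst add_mult_distrib_mat_vec[of _ n n]) auto
  show ?thesis
    unfolding det_0_iff_vec_prod_zero[OF M]
  proof
    assume "\<exists>v. v \<in> carrier_vec n \<and> v \<noteq> 0\<^sub>v n \<and> (1\<^sub>m n + A ^\<^sub>m k) *\<^sub>v v = 0\<^sub>v n"
    then obtain v where v: "v \<in> carrier_vec n" "v \<noteq> 0\<^sub>v n" and eq: "v + A ^\<^sub>m k *\<^sub>v v = 0\<^sub>v n"
      using mult by auto
    let ?f = "Polynomial.monom 1 0 + Polynomial.monom 1 k :: 'a poly"
    \<comment> \<open>As k > 0, the two monomials cannot merge into the constant 2, which would be
      zero in characteristic 2.\<close>
    have "Polynomial.coeff ?f k = 1" using k by simp
    then have "?f \<noteq> 0" by (metis coeff_0 zero_neq_one)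
    moreover have "mat_poly_vec ?f A v = 0\<^sub>v n"
      using eq A v by (simp only: mat_poly_vec_add[OF A v(1)] mat_poly_vec_monom[OF A v(1)]) simp
    ultimately obtain x where "poly ?f x = 0" "eigenvalue A x"
      using mat_poly_vec_eq_0_imp_eigenvalue[OF A v] by blast
    then show "\<exists>x. x ^ k = -1 \<and> eigenvalue A x"
      by (auto simp: poly_monom add_eq_0_iff)
  next
    assume "\<exists>x. x ^ k = -1 \<and> eigenvalue A x"
    then obtain x v where x: "x ^ k = -1" and ev: "eigenvector A v x" by (auto simp: eigenvalue_def)
    then have v: "v \<in> carrier_vec n" "v \<noteq> 0\<^sub>v n" using A by (auto simp: eigenvector_def)
    have "v + A ^\<^sub>m k *\<^sub>v v = 0\<^sub>v n"
      by (rule eq_vecI) (use v in \<open>auto simp: eigenvector_pow[OF A ev] x\<close>)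
    then show "\<exists>v. v \<in> carrier_vec n \<and> v \<noteq> 0\<^sub>v n \<and> (1\<^sub>m n + A ^\<^sub>m k) *\<^sub>v v = 0\<^sub>v n"
      using v mult by auto
  qed
qed

section \<open>Vieta-Fibonacci polynomials and the eigenvalues of the Toeplitz matrix\<close>

text \<open>The Vieta--Fibonacci polynomials: \<open>V\<^sub>n(y) = U\<^sub>n\<^sub>-\<^sub>1(y/2)\<close> for the Chebyshev polynomials \<open>U\<close> of
  the second kind.\<close>

fun vieta_fib :: "nat \<Rightarrow> 'a :: comm_ring_1 \<Rightarrow> 'a" where
  "vieta_fib 0 y = 0"
| "vieta_fib (Suc 0) y = 1"
| "vieta_fib (Suc (Suc n)) y = y * vieta_fib (Suc n) y - vieta_fib n y"

text \<open>This parity makes the zero set closed under negation: it transfers y = 2 to y = -2 and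
  later absorbs the sign in y = -(x - a)/b.\<close>

lemma vieta_fib_uminus: "vieta_fib n (- y) = (-1) ^ Suc n * vieta_fib n y"
proof (induction n y rule: vieta_fib.induct)
  case (3 y n)
  show ?case
    unfolding vieta_fib.simps 3 by (simp add: algebra_simps)
qed simp_all

lemma vieta_fib_2: "vieta_fib n 2 = of_nat n"
  by (induction n "2 :: 'a" rule: vieta_fib.induct) (auto simp: algebra_simps)

text \<open>Both s^n and s^-n solve the recurrence for y = s + 1/s. In this form without division it
  also holds for s = 1 and s = -1, but there both sides are 0 and \<open>vieta_fib_2\<close> has to
  supply the value.\<close>

lemma vieta_fib_plus_inverse:
  fixes s :: "'a :: field"
  assumes "s \<noteq> 0"
  shows "vieta_fib n (s + inverse s) * (s - inverse s) = s ^ n - inverse s ^ n"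
proof (induction n "s + inverse s" rule: vieta_fib.induct)
  case (3 n)
  have "vieta_fib (Suc (Suc n)) (s + inverse s) * (s - inverse s) =
    (s + inverse s) * (s ^ Suc n - inverse s ^ Suc n) - (s ^ n - inverse s ^ n)"
    unfolding 3[symmetric] by (simp add: algebra_simps)
  also have "\<dots> = s ^ Suc (Suc n) - inverse s ^ Suc (Suc n)"
    using assms by (simp add: field_simps)
  finally show ?case .
qed simp_all

text \<open>The zero boundary values stand in for the missing neighbours in the first and last rows,
  so that all rows obey one formula.\<close>

lemma tridiag_toeplitz_mult_vec:
  fixes f :: "nat \<Rightarrow> 'a :: comm_ring_1"
  assumes f: "f 0 = 0" "f (Suc n) = 0"
  shows "tridiag_toeplitz n a b *\<^sub>v vec n (\<lambda>i. f (Suc i)) =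
    vec n (\<lambda>i. a * f (Suc i) + b * (f i + f (Suc (Suc i))))"
proof (rule eq_vecI)
  fix i assume "i < dim_vec (vec n (\<lambda>i. a * f (Suc i) + b * (f i + f (Suc (Suc i)))))"
  then have i: "i < n" by simp
  have "(\<Sum>j = 0..<n. (if i = j then a else if i = j + 1 \<or> j = i + 1 then b else 0) * f (Suc j)) =
    (\<Sum>j = 0..<n. (if j = i then a * f (Suc i) else 0) + (if i = Suc j then b * f i else 0) +
       (if j = Suc i then b * f (Suc (Suc i)) else 0))"
    by (rule sum.cong) auto
  also have "\<dots> = a * f (Suc i) + b * f i + b * f (Suc (Suc i))"
  proof -
    have "(\<Sum>j = 0..<n. if i = Suc j then b * f i else 0) = b * f i"
      using i f by (cases i) (auto simp: sum.delta')
    moreover have "b * f (Suc (Suc i)) = 0" if "\<not> Suc i < n"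
      using that i f by (metis Suc_lessI mult_zero_right)
    ultimately show ?thesis
      using i by (simp add: sum.distrib sum.delta)
  qed
  finally show "(tridiag_toeplitz n a b *\<^sub>v vec n (\<lambda>i. f (Suc i))) $ i =
      vec n (\<lambda>i. a * f (Suc i) + b * (f i + f (Suc (Suc i)))) $ i"
    using i by (simp add: tridiag_toeplitz_def scalar_prod_def algebra_simps)
qed (simp add: tridiag_toeplitz_def)

text \<open>The recurrence determines an eigenvector up to its first entry: it is a multiple of
  (V_1(y), ..., V_n(y)). The boundary condition at n + 1 is then V_(n+1)(y) = 0.\<close>

lemma eigenvalue_tridiag_toeplitz_iff:
  fixes a b x :: "'a :: field"
  assumes b: "b \<noteq> 0" and n: "n > 0"
  shows "eigenvalue (tridiag_toeplitz n a b) x \<longleftrightarrow> vieta_fib (Suc n) ((x - a) / b) = 0"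
proof -
  let ?T = "tridiag_toeplitz n a b" and ?y = "(x - a) / b"
  have dim: "dim_row ?T = n" by (simp add: tridiag_toeplitz_def)
  have rec: "a * u + b * (w + z) = x * u \<longleftrightarrow> z = ?y * u - w" for u w z
    using b by (auto simp: field_simps)
  show ?thesis
  proof
    assume "eigenvalue ?T x"
    then obtain v where v: "v \<in> carrier_vec n" "v \<noteq> 0\<^sub>v n" and eq: "?T *\<^sub>v v = x \<cdot>\<^sub>v v"
      by (auto simp: eigenvalue_def eigenvector_def dim)
    \<comment> \<open>The entries of v are shifted to the indices 1, ..., n and padded with zeros at
      0 and n + 1.\<close>
    define f where "f j = (if j = 0 \<or> j = Suc n then 0 else vec_index v (j - 1))" for j
    have f: "f 0 = 0" "f (Suc n) = 0" by (simp_all add: f_def)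
    have v': "v = vec n (\<lambda>i. f (Suc i))"
      using v by (intro eq_vecI) (auto simp: f_def)
    have step: "f (Suc (Suc i)) = ?y * f (Suc i) - f i" if i: "i < n" for i
    proof -
      have "vec_index (?T *\<^sub>v v) i = x * f (Suc i)"
        using eq v i by (simp add: f_def)
      then have "a * f (Suc i) + b * (f i + f (Suc (Suc i))) = x * f (Suc i)"
        using i by (subst (asm) v') (simp add: tridiag_toeplitz_mult_vec[OF f])
      then show ?thesis by (simp only: rec)
    qed
    have fib: "j \<le> Suc n \<Longrightarrow> f j = f (Suc 0) * vieta_fib j ?y" for j
      by (induction j ?y rule: vieta_fib.induct) (auto simp: f step algebra_simps)
    have "f (Suc 0) \<noteq> 0"
    proof
      assume "f (Suc 0) = 0"
      then have "f (Suc i) = 0" if "i < n" for i using fib[of "Suc i"] that by simp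
      then have "v = 0\<^sub>v n" by (subst v', intro eq_vecI) auto
      then show False using v by simp
    qed
    then show "vieta_fib (Suc n) ?y = 0" using fib[of "Suc n"] f by simp
  next
    assume 0: "vieta_fib (Suc n) ?y = 0"
    let ?v = "vec n (\<lambda>i. vieta_fib (Suc i) ?y)"
    have "?T *\<^sub>v ?v = x \<cdot>\<^sub>v ?v"
      unfolding tridiag_toeplitz_mult_vec[where f = "\<lambda>i. vieta_fib i ?y", OF vieta_fib.simps(1) 0]
      by (intro eq_vecI) (use b in \<open>auto simp: field_simps\<close>)
    moreover have "?v \<noteq> 0\<^sub>v n"
    proof
      assume "?v = 0\<^sub>v n"
      then have "vec_index ?v 0 = vec_index (0\<^sub>v n) 0" by (rule arg_cong)
      then show False using n by simp
    qed
    ultimately show "eigenvalue ?T x"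
      unfolding eigenvalue_def eigenvector_def dim by (intro exI[of _ ?v]) simp
  qed
qed

section \<open>Frobenius and roots of unity\<close>

lemma frobenius_pow_eq_iff:
  fixes x y :: "'a :: field"
  assumes "Factorial_Ring.prime CHAR('a)"
  shows "x ^ CHAR('a) ^ r = y ^ CHAR('a) ^ r \<longleftrightarrow> x = y"
proof
  assume eq: "x ^ CHAR('a) ^ r = y ^ CHAR('a) ^ r"
  \<comment> \<open>Additivity of Frobenius turns the equality into (x - y)^(p^r) = 0.\<close>
  have "((x - y) + y) ^ CHAR('a) ^ r = (x - y) ^ CHAR('a) ^ r + y ^ CHAR('a) ^ r"
    by (rule freshmans_dream') (use assms in auto)
  then show "x = y" using eq by simp
qed simp

lemma primitive_root_of_unity_power_eq_iff:
  fixes z :: "'a :: field"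
  assumes "primitive_root_of_unity d z" "i < d" "j < d"
  shows "z ^ i = z ^ j \<longleftrightarrow> i = j"
proof -
  have z: "z ^ d = 1" "d > 0" and prim: "\<And>e. 0 < e \<Longrightarrow> e < d \<Longrightarrow> z ^ e \<noteq> 1"
    using assms by (auto simp: primitive_root_of_unity_def)
  have "z \<noteq> 0" using z by (metis power_eq_0_iff zero_neq_one)
  have *: "z ^ i \<noteq> z ^ j" if "i < j" "j < d" for i j
  proof
    assume "z ^ i = z ^ j"
    also have "\<dots> = z ^ i * z ^ (j - i)" using that by (simp flip: power_add)
    finally have "z ^ (j - i) = 1" using \<open>z \<noteq> 0\<close> by simp
    then show False using prim[of "j - i"] that by simp
  qed
  show ?thesis using *[of i j] *[of j i] assms by (metis linorder_neqE_nat)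
qed

text \<open>The d distinct powers of z are roots of X^d - 1, which has at most d roots, so they are
  all of them.\<close>

lemma primitive_root_of_unity_generates:
  fixes z x :: "'a :: field"
  assumes z: "primitive_root_of_unity d z" and x: "x ^ d = 1"
  obtains i where "i < d" "x = z ^ i"
proof -
  let ?f = "Polynomial.monom 1 d - 1 :: 'a poly" and ?R = "{y :: 'a. y ^ d = 1}"
  have d: "d > 0" and zd: "z ^ d = 1" using z by (auto simp: primitive_root_of_unity_def)
  have c: "Polynomial.coeff ?f d = 1" using d by (simp add: one_poly_eq_simps)
  then have f: "?f \<noteq> 0" by (metis coeff_0 zero_neq_one)
  have R: "?R = {y. poly ?f y = 0}" by (simp add: poly_monom)
  have deg: "Polynomial.degree ?f \<le> d"
    by (rule degree_diff_le) (auto simp: degree_monom_le)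
  have "finite ?R" using poly_roots_finite[OF f] unfolding R .
  moreover have "(\<lambda>i. z ^ i) ` {..<d} \<subseteq> ?R"
    by (auto simp flip: power_mult simp: mult.commute[of _ d]) (simp add: power_mult zd)
  moreover have "card ?R \<le> card ((\<lambda>i. z ^ i) ` {..<d})"
  proof -
    have "inj_on (\<lambda>i. z ^ i) {..<d}"
      using primitive_root_of_unity_power_eq_iff[OF z] by (auto simp: inj_on_def)
    then show ?thesis using card_poly_roots_bound[OF f] deg R by (simp add: card_image)
  qed
  ultimately have "(\<lambda>i. z ^ i) ` {..<d} = ?R" by (rule card_seteq)
  then show ?thesis using x that by blast
qed

text \<open>z^(2k) squares to 1 without being 1, so it is -1. Hence (z^i)^(2k) = (-1)^i, and the
  solutions are the odd powers of z.\<close>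

lemma power_eq_minus_one_iff_odd_power:
  fixes z :: "'a :: field"
  assumes z: "primitive_root_of_unity (4 * k) z"
  shows "x ^ (2 * k) = -1 \<longleftrightarrow> (\<exists>j. 1 \<le> j \<and> j \<le> 2 * k \<and> x = z ^ (2 * j + 1))"
proof -
  have k: "k > 0" and z4: "z ^ (4 * k) = 1" and ne: "z ^ (2 * k) \<noteq> 1"
    using z by (auto simp: primitive_root_of_unity_def)
  have "(z ^ (2 * k))\<^sup>2 = 1" using z4 by (simp flip: power_mult add: mult.commute)
  then have z2: "z ^ (2 * k) = -1" using ne by (simp add: power2_eq_1_iff)
  then have m1: "(-1 :: 'a) \<noteq> 1" using ne by simp
  have pow: "(z ^ i) ^ (2 * k) = (-1) ^ i" for i
    by (metis power_mult mult.commute z2)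
  show ?thesis
  proof
    assume x: "x ^ (2 * k) = -1"
    then have "x ^ (2 * k * 2) = 1" by (simp only: power_mult) simp
    then have "x ^ (4 * k) = 1" by (simp add: mult.commute mult.left_commute)
    then obtain i where i: "i < 4 * k" "x = z ^ i"
      by (rule primitive_root_of_unity_generates[OF z])
    then have "odd i" using x pow[of i] m1 by (cases "even i") auto
    then obtain l where l: "i = 2 * l + 1" by (auto elim: oddE)
    show "\<exists>j. 1 \<le> j \<and> j \<le> 2 * k \<and> x = z ^ (2 * j + 1)"
    \<comment> \<open>The range of j starts at 1, so the exponent 1 is reached as 4k + 1, with j =
      2k.\<close>
    proof (cases "l = 0")
      case True
      then have "x = z ^ (2 * (2 * k) + 1)" using i l z4 by (simp add: power_add)
      then show ?thesis using k by (intro exI[of _ "2 * k"]) auto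
    next
      case False
      then show ?thesis using i l by (intro exI[of _ l]) auto
    qed
  qed (auto simp only: pow, simp)
qed

section \<open>Zeros of the Vieta-Fibonacci polynomials\<close>

lemma alg_closed_plus_inverse:
  fixes y :: "'a :: alg_closed_field"
  obtains s where "s \<noteq> 0" "y = s + inverse s"
proof -
  obtain s where "poly [:1, - y, 1:] s = 0"
    using alg_closed_imp_poly_has_root[of "[:1, - y, 1:]"] by auto
  then have s: "1 + s * s = y * s" by (simp add: algebra_simps)
  then have "s \<noteq> 0" by auto
  moreover have "y = s + inverse s" using s \<open>s \<noteq> 0\<close> by (simp add: field_simps)
  ultimately show ?thesis by (rule that)
qed

text \<open>Equal sums make s a root of X^2 - (u + 1/u) X + 1 = (X - u)(X - 1/u).\<close>

lemma plus_inverse_eq_iff: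
  fixes s u :: "'a :: field"
  assumes "s \<noteq> 0" "u \<noteq> 0"
  shows "s + inverse s = u + inverse u \<longleftrightarrow> s = u \<or> s = inverse u"
proof -
  have "(s - u) * (s - inverse u) = s * (s + inverse s - (u + inverse u))"
    using assms by (simp add: field_simps)
  then show ?thesis using assms by (metis eq_iff_diff_eq_0 mult_eq_0_iff)
qed

text \<open>Let y = s + 1/s and N = p^r M. If s^2 = 1, the value is N up to sign, which vanishes iff
  r \<ge> 1. Otherwise a zero means s^(2N) = 1; Frobenius strips p^r, so s is a power of z.\<close>

lemma vieta_fib_eq_0_iff:
  fixes y z :: "'a :: alg_closed_field"
  assumes p: "Factorial_Ring.prime CHAR('a)" "odd CHAR('a)" and M: "\<not> CHAR('a) dvd M"
    and z: "primitive_root_of_unity (2 * M) z"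
  shows "vieta_fib (CHAR('a) ^ r * M) y = 0 \<longleftrightarrow>
    (r \<ge> 1 \<and> (y = 2 \<or> y = -2)) \<or> (\<exists>i. 1 \<le> i \<and> i < M \<and> y = z ^ i + inverse (z ^ i))"
proof -
  let ?N = "CHAR('a) ^ r * M"
  have z2: "z ^ (2 * M) = 1" and M0: "M > 0" using z by (auto simp: primitive_root_of_unity_def)
  have z0: "z \<noteq> 0" using z2 M0 by (metis power_eq_0_iff zero_neq_one mult_pos_pos zero_less_numeral)
  have zi2: "(z ^ i) ^ 2 \<noteq> 1" if "1 \<le> i" "i < M" for i
    using z that unfolding primitive_root_of_unity_def by (simp flip: power_mult)
  have N0: "of_nat ?N = (0 :: 'a) \<longleftrightarrow> r \<ge> 1"
    using M p by (auto simp: of_nat_eq_0_iff_char_dvd prime_dvd_mult_iff prime_dvd_power_iff)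
  obtain s where s: "s \<noteq> 0" "y = s + inverse s" by (rule alg_closed_plus_inverse)
  have rhs: "y = z ^ i + inverse (z ^ i) \<longleftrightarrow> s = z ^ i \<or> s = inverse (z ^ i)" for i
    using plus_inverse_eq_iff[of s "z ^ i"] s z0 by auto
  show ?thesis
  proof (cases "s\<^sup>2 = 1")
    case True
    then have s1: "s = 1 \<or> s = -1" by (simp add: power2_eq_1_iff)
    then have y: "y = 2 \<or> y = -2" using s by auto
    \<comment> \<open>For 0 < i < M the square of z^i is not 1, so the two families of zeros do not
      meet.\<close>
    have "\<not> (1 \<le> i \<and> i < M \<and> y = z ^ i + inverse (z ^ i))" for i
      using rhs zi2 True by (metis inverse_1 inverse_inverse_eq power_inverse)
    moreover have "vieta_fib ?N y = 0 \<longleftrightarrow> r \<ge> 1"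
      using y N0 by (auto simp: vieta_fib_uminus vieta_fib_2 simp del: of_nat_mult of_nat_power)
    ultimately show ?thesis using y by auto
  next
    case False
    then have "s - inverse s \<noteq> 0" using s by (auto simp: power2_eq_square field_simps)
    then have "vieta_fib ?N y = 0 \<longleftrightarrow> vieta_fib ?N y * (s - inverse s) = 0" by simp
    also have "\<dots> \<longleftrightarrow> s ^ ?N = inverse s ^ ?N"
      using s by (simp add: vieta_fib_plus_inverse)
    also have "\<dots> \<longleftrightarrow> s ^ (2 * ?N) = 1"
      using s by (auto simp: power_inverse mult_2 power_add field_simps)
    also have "s ^ (2 * ?N) = (s ^ (2 * M)) ^ CHAR('a) ^ r"
      by (simp flip: power_mult add: mult_ac)
    also have "\<dots> = 1 \<longleftrightarrow> s ^ (2 * M) = 1"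
      using frobenius_pow_eq_iff[OF p(1), of "s ^ (2 * M)" r 1] by simp
    also have "\<dots> \<longleftrightarrow> (\<exists>i. 1 \<le> i \<and> i < M \<and> (s = z ^ i \<or> s = inverse (z ^ i)))"
    proof
      assume "s ^ (2 * M) = 1"
      then obtain i where i: "i < 2 * M" "s = z ^ i"
        by (rule primitive_root_of_unity_generates[OF z])
      have "i \<noteq> 0" using i False by (intro notI) auto
      moreover have "i \<noteq> M" using i False z2 by (intro notI) (simp flip: power_mult add: mult.commute)
      \<comment> \<open>The exponents 0 and M give s^2 = 1 and are excluded. Those above M reflect
        to 2M - i, since s and 1/s give the same y.\<close>
      moreover have "s = inverse (z ^ (2 * M - i))"
      proof -
        have "z ^ i * z ^ (2 * M - i) = 1" using i z2 by (simp flip: power_add)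
        then show ?thesis using i by (metis inverse_unique inverse_inverse_eq)
      qed
      ultimately show "\<exists>i. 1 \<le> i \<and> i < M \<and> (s = z ^ i \<or> s = inverse (z ^ i))"
        using i by (cases "i < M") (auto intro: exI[of _ i] exI[of _ "2 * M - i"])
    next
      assume "\<exists>i. 1 \<le> i \<and> i < M \<and> (s = z ^ i \<or> s = inverse (z ^ i))"
      moreover have "(z ^ i) ^ (2 * M) = 1" for i
        using z2 by (metis power_mult mult.commute power_one)
      ultimately show "s ^ (2 * M) = 1" by (auto simp: power_inverse)
    qed
    also have "\<dots> \<longleftrightarrow> (\<exists>i. 1 \<le> i \<and> i < M \<and> y = z ^ i + inverse (z ^ i))"
      by (simp only: rhs)
    finally have "vieta_fib ?N y = 0 \<longleftrightarrow> (\<exists>i. 1 \<le> i \<and> i < M \<and> y = z ^ i + inverse (z ^ i))" .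
    moreover have "y \<noteq> 2" "y \<noteq> -2"
      using plus_inverse_eq_iff[of s 1] plus_inverse_eq_iff[of s "-1"] s False by auto
    ultimately show ?thesis by simp
  qed
qed

section \<open>The LCD criterion for Toeplitz codes\<close>

lemma tridiag_toeplitz_carrier [simp]: "tridiag_toeplitz n a b \<in> carrier_mat n n"
  by (simp add: tridiag_toeplitz_def)

lemma transpose_tridiag_toeplitz [simp]: "(tridiag_toeplitz n a b)\<^sup>T = tridiag_toeplitz n a b"
  by (rule eq_matI) (auto simp: tridiag_toeplitz_def)

lemma map_mat_tridiag_toeplitz:
  "f 0 = 0 \<Longrightarrow> map_mat f (tridiag_toeplitz n a b) = tridiag_toeplitz n (f a) (f b)"
  by (rule eq_matI) (auto simp: tridiag_toeplitz_def)

text \<open>By symmetry of T, the block B = T^k has B B^T = T^(2k). The injective homomorphism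
  \<open>to_ac\<close> preserves whether the determinant vanishes, so the eigenvalue criterion can
  be applied over the closure.\<close>

lemma toeplitz_code_is_LCD_iff:
  fixes a b :: "'a :: field"
  assumes b: "b \<noteq> 0" and n: "n > 0" and k: "k > 0"
  shows "is_LCD (2 * n) (toeplitz_code n k a b) \<longleftrightarrow>
    (\<forall>x :: 'a alg_closure. x ^ (2 * k) = -1 \<longrightarrow>
      vieta_fib (Suc n) ((x - to_ac a) / to_ac b) \<noteq> 0)"
proof -
  interpret ac: inj_comm_ring_hom "to_ac :: 'a \<Rightarrow> 'a alg_closure"
    by unfold_locales auto
  let ?T = "tridiag_toeplitz n a b"
  have T: "?T \<in> carrier_mat n n" by simp
  let ?S = "tridiag_toeplitz n (to_ac a) (to_ac b)"
  have "is_LCD (2 * n) (toeplitz_code n k a b) \<longleftrightarrow> det (1\<^sub>m n + ?T ^\<^sub>m k * (?T ^\<^sub>m k)\<^sup>T) \<noteq> 0"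
    using systematic_is_LCD_iff[OF pow_carrier_mat[OF T]] by (simp add: toeplitz_code_def mult_2)
  also have "?T ^\<^sub>m k * (?T ^\<^sub>m k)\<^sup>T = ?T ^\<^sub>m (2 * k)"
    by (simp add: transpose_pow_mat[OF T] mult_2 pow_mat_add[OF T])
  also have "det (1\<^sub>m n + ?T ^\<^sub>m (2 * k)) \<noteq> 0 \<longleftrightarrow>
      det (map_mat to_ac (1\<^sub>m n + ?T ^\<^sub>m (2 * k))) \<noteq> 0"
    by simp
  also have "map_mat to_ac (1\<^sub>m n + ?T ^\<^sub>m (2 * k)) = 1\<^sub>m n + ?S ^\<^sub>m (2 * k)"
  proof -
    have "map_mat to_ac (1\<^sub>m n + P) = 1\<^sub>m n + map_mat to_ac P"
      if "P \<in> carrier_mat n n" for P :: "'a mat"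
      by (rule eq_matI) (use that in auto)
    from this[OF pow_carrier_mat[OF T]] show ?thesis
      by (simp add: ac.mat_hom_pow[OF T] map_mat_tridiag_toeplitz)
  qed
  also have "det (1\<^sub>m n + ?S ^\<^sub>m (2 * k)) \<noteq> 0 \<longleftrightarrow>
      (\<forall>x. x ^ (2 * k) = -1 \<longrightarrow> vieta_fib (Suc n) ((x - to_ac a) / to_ac b) \<noteq> 0)"
    using b n k by (auto simp: det_one_add_pow_mat_eq_0_iff[of _ n] eigenvalue_tridiag_toeplitz_iff)
  finally show ?thesis .
qed

lemma toeplitz_code_is_LCD_iff_notin:
  fixes a b :: "'a :: field"
  assumes p: "Factorial_Ring.prime CHAR('a)" "odd CHAR('a)"
    and b: "b \<noteq> 0" and n: "n > 0" and k: "k = CHAR('a) ^ t * k'" "k > 0"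
    and z: "primitive_root_of_unity (4 * k') (z :: 'a alg_closure)"
  shows "is_LCD (2 * n) (toeplitz_code n k a b) \<longleftrightarrow>
    to_ac (a / b) \<notin> {z ^ (2 * j + 1) / to_ac b + y | j y.
      1 \<le> j \<and> j \<le> 2 * k' \<and> vieta_fib (Suc n) y = 0}"
proof -
  have "x ^ (2 * k) = -1 \<longleftrightarrow> x ^ (2 * k') = -1" for x :: "'a alg_closure"
  proof -
    have "x ^ (2 * k) = (x ^ (2 * k')) ^ CHAR('a alg_closure) ^ t"
      by (simp add: k flip: power_mult) (simp add: mult_ac)
    \<comment> \<open>p^t is odd, so -1 is its own p^t-th power and Frobenius removes the p-part of
      k.\<close>
    moreover have "(-1 :: 'a alg_closure) = (-1) ^ CHAR('a alg_closure) ^ t"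
      using p by simp
    ultimately show ?thesis
      using frobenius_pow_eq_iff[of "x ^ (2 * k')" t "-1"] p by simp
  qed
  then have *: "x ^ (2 * k) = -1 \<longleftrightarrow> (\<exists>j. 1 \<le> j \<and> j \<le> 2 * k' \<and> x = z ^ (2 * j + 1))" for x
    using power_eq_minus_one_iff_odd_power[OF z] by simp
  \<comment> \<open>Solving for y yields the negative of the argument in the eigenvalue criterion;
    parity makes this harmless.\<close>
  have eq: "to_ac (a / b) = x / to_ac b + y \<longleftrightarrow> y = - ((x - to_ac a) / to_ac b)" for x y
    by (auto simp: diff_divide_distrib)
  show ?thesis
    unfolding toeplitz_code_is_LCD_iff[OF b n k(2)] * mem_Collect_eq eq
    by (auto simp: vieta_fib_uminus simp del: vieta_fib.simps)
qed

theorem theorem6p8: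
  fixes a b :: "'a :: {field, finite}"
    and \<mu> :: "'a alg_closure"
    and p q n k r m t k' :: nat
  assumes p_def: "p = CHAR('a)"
    and p_odd: "odd p"
    and q_def: "q = CARD('a)"
    and b_nz: "b \<noteq> 0"
    and n_ge: "n \<ge> 2"
    and k_ge: "k \<ge> 1"
    and n_decomp: "n + 1 = p ^ r * (m + 1)"
    and r_largest: "\<forall>r' m'. n + 1 = p ^ r' * (m' + 1) \<longrightarrow> r' \<le> r"
    and k_decomp: "k = p ^ t * k'"
    and k'_coprime: "coprime k' q"
    and mu: "primitive_root_of_unity (4 * k') \<mu>"
  shows
    "(r = 0 \<longrightarrow>
        (\<forall>\<theta> :: 'a alg_closure. primitive_root_of_unity (2 * (n + 1)) \<theta> \<longrightarrow>
          (is_LCD (2 * n) (toeplitz_code n k a b) \<longleftrightarrow>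
            to_ac (a / b) \<notin>
              {\<mu> ^ (2 * j + 1) / to_ac b + \<theta> powi int i + \<theta> powi (- int i) | i j.
                 1 \<le> i \<and> i \<le> n \<and> 1 \<le> j \<and> j \<le> 2 * k'})))
     \<and> (r \<ge> 1 \<and> m \<ge> 1 \<longrightarrow>
        (\<forall>\<theta> :: 'a alg_closure. primitive_root_of_unity (2 * (m + 1)) \<theta> \<longrightarrow>
          (is_LCD (2 * n) (toeplitz_code n k a b) \<longleftrightarrow>
            to_ac (a / b) \<notin>
              {\<mu> ^ (2 * j + 1) / to_ac b + 2 | j. 1 \<le> j \<and> j \<le> 2 * k'}
              \<union> {\<mu> ^ (2 * j + 1) / to_ac b - 2 | j. 1 \<le> j \<and> j \<le> 2 * k'}
              \<union> {\<mu> ^ (2 * j + 1) / to_ac b + \<theta> powi int i + \<theta> powi (- int i) | i j.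
                 1 \<le> i \<and> i \<le> m \<and> 1 \<le> j \<and> j \<le> 2 * k'})))
     \<and> (r \<ge> 1 \<and> m = 0 \<longrightarrow>
          (is_LCD (2 * n) (toeplitz_code n k a b) \<longleftrightarrow>
            to_ac (a / b) \<notin>
              {\<mu> ^ (2 * j + 1) / to_ac b + 2 | j. 1 \<le> j \<and> j \<le> 2 * k'}
              \<union> {\<mu> ^ (2 * j + 1) / to_ac b - 2 | j. 1 \<le> j \<and> j \<le> 2 * k'}))"
proof -
  let ?L = "is_LCD (2 * n) (toeplitz_code n k a b)"
  let ?\<beta> = "to_ac b"
  have p: "Factorial_Ring.prime CHAR('a alg_closure)" "odd CHAR('a alg_closure)"
    using p_def p_odd finite_imp_CHAR_pos[where 'a = 'a] prime_CHAR_semidom[where 'a = 'a] by auto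
  have M: "\<not> CHAR('a alg_closure) dvd m + 1"
  proof
    assume "CHAR('a alg_closure) dvd m + 1"
    then obtain c where c: "m + 1 = p * c" by (auto simp: p_def)
    then have "c > 0" by (cases c) auto
    \<comment> \<open>Another factor p in m + 1 would allow the exponent r + 1; c - 1 fits the shape
      m' + 1 of the cofactor.\<close>
    then have "n + 1 = p ^ Suc r * ((c - 1) + 1)"
      unfolding n_decomp c by (simp add: mult_ac)
    then show False using r_largest by (metis Suc_n_not_le_n)
  qed
  have LCD: "?L \<longleftrightarrow> to_ac (a / b) \<notin> {\<mu> ^ (2 * j + 1) / ?\<beta> + y | j y.
      1 \<le> j \<and> j \<le> 2 * k' \<and> vieta_fib (Suc n) y = 0}"
    by (rule toeplitz_code_is_LCD_iff_notin[OF _ _ b_nz _ k_decomp[unfolded p_def] _ mu])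
      (use p n_ge k_ge in auto)
  have zeros: "vieta_fib (Suc n) y = 0 \<longleftrightarrow>
      (r \<ge> 1 \<and> (y = 2 \<or> y = -2)) \<or>
      (\<exists>i. 1 \<le> i \<and> i \<le> m \<and> y = \<theta> powi int i + \<theta> powi (- int i))"
    if "primitive_root_of_unity (2 * (m + 1)) \<theta>" for y \<theta> :: "'a alg_closure"
    using vieta_fib_eq_0_iff[OF p M that, of r y] n_decomp
    by (simp add: p_def less_Suc_eq_le power_int_minus)
  have case1: "?L \<longleftrightarrow> to_ac (a / b) \<notin>
      {\<mu> ^ (2 * j + 1) / ?\<beta> + \<theta> powi int i + \<theta> powi (- int i) | i j.
        1 \<le> i \<and> i \<le> n \<and> 1 \<le> j \<and> j \<le> 2 * k'}"
    if "r = 0" "primitive_root_of_unity (2 * (n + 1)) \<theta>" for \<theta>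
  proof -
    have "m = n" using that n_decomp by simp
    then have "vieta_fib (Suc n) y = 0 \<longleftrightarrow>
        (\<exists>i. 1 \<le> i \<and> i \<le> n \<and> y = \<theta> powi int i + \<theta> powi (- int i))" for y
      using zeros[of \<theta> y] that by simp
    then show ?thesis
      by (simp only: LCD mem_Collect_eq add.assoc) blast
  qed
  have case2: "?L \<longleftrightarrow> to_ac (a / b) \<notin>
      {\<mu> ^ (2 * j + 1) / ?\<beta> + 2 | j. 1 \<le> j \<and> j \<le> 2 * k'}
      \<union> {\<mu> ^ (2 * j + 1) / ?\<beta> - 2 | j. 1 \<le> j \<and> j \<le> 2 * k'}
      \<union> {\<mu> ^ (2 * j + 1) / ?\<beta> + \<theta> powi int i + \<theta> powi (- int i) | i j.
        1 \<le> i \<and> i \<le> m \<and> 1 \<le> j \<and> j \<le> 2 * k'}"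
    if "r \<ge> 1" "primitive_root_of_unity (2 * (m + 1)) \<theta>" for \<theta>
  proof -
    have "vieta_fib (Suc n) y = 0 \<longleftrightarrow> y = 2 \<or> y = -2 \<or>
        (\<exists>i. 1 \<le> i \<and> i \<le> m \<and> y = \<theta> powi int i + \<theta> powi (- int i))" for y
      using zeros[OF that(2), of y] that(1) by simp
    then show ?thesis
      by (simp only: LCD mem_Collect_eq add.assoc Un_iff diff_conv_add_uminus) blast
  qed
  \<comment> \<open>For \<open>m = 0\<close> this is the previous case with \<open>\<theta> = -1\<close>, whose \<open>\<theta>\<close>-part is empty.\<close>
  have case3: "?L \<longleftrightarrow> to_ac (a / b) \<notin>
      {\<mu> ^ (2 * j + 1) / ?\<beta> + 2 | j. 1 \<le> j \<and> j \<le> 2 * k'}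
      \<union> {\<mu> ^ (2 * j + 1) / ?\<beta> - 2 | j. 1 \<le> j \<and> j \<le> 2 * k'}"
    if "r \<ge> 1" "m = 0"
  proof -
    \<comment> \<open>Odd characteristic gives -1 \<noteq> 1, so -1 has order exactly 2 = 2(m +
      1).\<close>
    have "(2 :: 'a alg_closure) \<noteq> 0"
      using p by (metis of_nat_eq_0_iff_char_dvd of_nat_numeral primes_dvd_imp_eq two_is_prime_nat dvd_refl)
    then have "primitive_root_of_unity (2 * (m + 1)) (-1 :: 'a alg_closure)"
      using that by (auto simp: primitive_root_of_unity_def less_2_cases_iff eq_neg_iff_add_eq_0
          dest!: sym[of "-1"])
    from case2[OF that(1) this] that show ?thesis by simp
  qed
  show ?thesis using case1 case2 case3 by simp
qed

end
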